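(* Suppose that $X\subseteq\mathbb{R}^{mn}$ is a convex and closed set, that the solution set $D^*$ of the problem $\min\{f(x) : x\in X,\ Ax=b\}$ is nonempty, and that $f:\mathbb{R}^{mn}\to\mathbb{R}$ is a convex function. Let $\{w^k\}$, $w^k=(x^k,y^k)$, be generated by Method (PDM) with index sets $I_k\subseteq L$ and stepsizes $\lambda_k$ such that, for some $\tau\in(0,1)$, $$\lambda_k\in\left[\tau,\ \frac{\sqrt{1-\tau}}{\sqrt{2}\,\|A_{(k)}\|}\right]\quad\text{for all } k\ge 1.$$ (i) If there exists a nonempty basic index set $I\subseteq L$ such that $I\subseteq I_k$ for all $k\ge1$, then the sequence $\{w^k\}$ has limit points and each of these limit points belongs to $W^*$. (ii) If, in addition, $I=I_{k_s}$ for some infinite subsequence $\{w^{k_s}\}$, then $\lim_{k\to\infty}w^k=w^*$ for some $w^*\in W^*$.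
   Context: Let $m,n,l$ be positive integers and $L=\{1,\dots,l\}$. Let $X\subseteq\mathbb{R}^{mn}$, $f:\mathbb{R}^{mn}\to\mathbb{R}$, let $A$ be a real matrix with $ln$ rows and $mn$ columns consisting of stacked $n\times mn$ blocks $A_1,\dots,A_l$, and let $b=(b_i)_{i\in L}\in\mathbb{R}^{ln}$ with $b_i\in\mathbb{R}^n$. For $I\subseteq L$, $A_I$ is the matrix of stacked blocks $A_i$, $i\in I$, and $b_I=(b_i)_{i\in I}$ (so $A_L=A$, $b_L=b$). For $I\subset J\subseteq L$ (equality allowed), $I$ is a basic index set with respect to $J$ if $A_Ix=b_I$ implies $A_Jx=b_J$ (for every $x\in\mathbb{R}^{mn}$). A basic index set is a basic index set with respect to $L$. Lagrange function: $\mathcal{L}(x,y)=f(x)+\langle y,Ax-b\rangle$. For $I\subseteq L$ let $Y_I=\{y=(y_i)_{i\in L}\in\mathbb{R}^{ln} : y_i=\mathbf{0}\in\mathbb{R}^n \text{ for } i\notin I\}$. The set $W^*$ is the set of saddle points of the problem $\min\{f(x) : x\in X,\ Ax=b\}$, that is, of pairs $(x^*,y^* )\in X\times\mathbb{R}^{ln}$ such that $\mathcal{L}(x^*,y)\le\mathcal{L}(x^*,y^* )\le\mathcal{L}(x,y^* )$ for all $y\in\mathbb{R}^{ln}$ and all $x\in X$. Method (PDM): choose $I_0\subseteq L$ and $w^0=(x^0,y^0)\in X\times Y_{I_0}$. For $k=1,2,\dots$ choose $I_k\subseteq L$ and $\lambda_k>0$, and set $p^k=\pi_{Y_{(k)}}[y^{k-1}+\lambda_k(Ax^{k-1}-b)]$,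 $x^k=\operatorname{argmin}\{f(x)+\langle p^k,Ax-b\rangle+0.5\lambda_k^{-1}\|x-x^{k-1}\|^2 : x\in X\}$, $y^k=\pi_{Y_{(k)}}[y^{k-1}+\lambda_k(Ax^k-b)]$, where $\pi_U(u)$ is the projection of $u$ onto $U$. The subscript $(k)$ abbreviates $I_k$: $Y_{(k)}=Y_{I_k}$, $A_{(k)}=A_{I_k}$. $\|\cdot\|$ is the Euclidean norm for vectors and the induced operator norm for matrices. A limit point of a sequence is the limit of some convergent subsequence.
   Formalization: The formal theorem additionally assumes that W* is nonempty; without this the claim fails, e.g. for X={(x1,x2): x1²≤x2}, f=x1, A=(0 1), b=0, τ=λ_k=1/2, where D*={0} but W* is empty. *)

theory Defs
  imports "HOL-Analysis.Analysis"
begin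

(* A stacked object with blocks indexed by 'l and n entries (or rows) per block is a vector
   indexed by pairs (i, j); a stacked matrix is a vector of rows, so the two definitions below
   apply to A and to b alike. *)
definition block :: "'a ^ ('l::finite \<times> 'n::finite) \<Rightarrow> 'l \<Rightarrow> 'a ^ 'n" where
  "block v i = (\<chi> j. v $ (i, j))"

(* A_I and b_I: since I varies with the iteration, the blocks outside I are replaced by zero
   instead of being deleted. The two lemmas below show that neither the solutions of
   A_I x = b_I nor the norms of the vectors A_I x (hence the operator norm of A_I) depend on this. *)
definition sub_blocks ::
  "'l set \<Rightarrow> ('a::zero) ^ ('l::finite \<times> 'n::finite) \<Rightarrow> 'a ^ ('l \<times> 'n)" where
  "sub_blocks I v = (\<chi> r. if fst r \<in> I then v $ r else 0)"

lemma sub_blocks_system_iff: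
  fixes A :: "real ^ 'd ^ ('l::finite \<times> 'n::finite)"
  shows "sub_blocks I A *v x = sub_blocks I b \<longleftrightarrow> (\<forall>i\<in>I. block A i *v x = block b i)"
proof -
  have "sub_blocks I A *v x = sub_blocks I b \<longleftrightarrow>
      (\<forall>i j. i \<in> I \<longrightarrow> (\<Sum>c\<in>UNIV. A $ (i, j) $ c * x $ c) = b $ (i, j))"
    by (auto simp: vec_eq_iff sub_blocks_def matrix_vector_mult_def)
  also have "\<dots> \<longleftrightarrow> (\<forall>i\<in>I. block A i *v x = block b i)"
    by (auto simp: vec_eq_iff block_def matrix_vector_mult_def)
  finally show ?thesis .
qed

lemma norm_sub_blocks_mult:
  fixes A :: "real ^ 'd ^ ('l::finite \<times> 'n::finite)"
  shows "norm (sub_blocks I A *v x) = sqrt (\<Sum>i\<in>I. (norm (block A i *v x))\<^sup>2)"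
proof -
  let ?g = "\<lambda>i. \<Sum>j\<in>UNIV. (\<Sum>c\<in>UNIV. A $ (i, j) $ c * x $ c)\<^sup>2"
  have "(norm (sub_blocks I A *v x))\<^sup>2 =
      (\<Sum>r\<in>UNIV. ((sub_blocks I A *v x) $ r)\<^sup>2)"
    by (simp add: norm_vec_def L2_set_def sum_nonneg)
  also have "\<dots> = (\<Sum>i\<in>UNIV. \<Sum>j\<in>UNIV. ((sub_blocks I A *v x) $ (i, j))\<^sup>2)"
    by (simp add: sum.cartesian_product case_prod_unfold)
  also have "\<dots> = (\<Sum>i\<in>UNIV. if i \<in> I then ?g i else 0)"
    by (intro sum.cong refl) (auto simp: sub_blocks_def matrix_vector_mult_def)
  also have "\<dots> = (\<Sum>i\<in>I. ?g i)"
    by (subst sum.inter_restrict [symmetric]) auto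
  also have "\<dots> = (\<Sum>i\<in>I. (norm (block A i *v x))\<^sup>2)"
    by (intro sum.cong refl)
       (simp add: norm_vec_def L2_set_def sum_nonneg block_def matrix_vector_mult_def)
  finally show ?thesis
    by (metis norm_ge_zero real_sqrt_unique)
qed

definition basic_wrt ::
  "real ^ 'd ^ ('l::finite \<times> 'n::finite) \<Rightarrow> real ^ ('l \<times> 'n) \<Rightarrow> 'l set \<Rightarrow> 'l set \<Rightarrow> bool" where
  "basic_wrt A b I J \<longleftrightarrow> I \<subseteq> J \<and>
     (\<forall>x. sub_blocks I A *v x = sub_blocks I b \<longrightarrow> sub_blocks J A *v x = sub_blocks J b)"

definition basic :: "real ^ 'd ^ ('l::finite \<times> 'n::finite) \<Rightarrow> real ^ ('l \<times> 'n) \<Rightarrow> 'l set \<Rightarrow> bool" where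
  "basic A b I \<longleftrightarrow> basic_wrt A b I UNIV"

definition Y_space :: "'l set \<Rightarrow> (real ^ ('l::finite \<times> 'n::finite)) set" where
  "Y_space I = {y. \<forall>i. i \<notin> I \<longrightarrow> block y i = 0}"

definition solutions ::
  "(real ^ 'd) set \<Rightarrow> (real ^ 'd \<Rightarrow> real) \<Rightarrow> real ^ 'd ^ 'r \<Rightarrow> real ^ 'r \<Rightarrow> (real ^ 'd) set" where
  "solutions X f A b = {x. is_arg_min f (\<lambda>x. x \<in> X \<and> A *v x = b) x}"

definition lagrangian ::
  "(real ^ 'd \<Rightarrow> real) \<Rightarrow> real ^ 'd ^ 'r \<Rightarrow> real ^ 'r \<Rightarrow> real ^ 'd \<Rightarrow> real ^ 'r \<Rightarrow> real" where
  "lagrangian f A b x y = f x + y \<bullet> (A *v x - b)"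

(* This set may be empty although the problem is convex and solvable: minimise x1 over
   X = {(x1, x2). x1^2 <= x2} subject to x2 = 0. Hence convexity and solvability alone cannot imply
   convergence to a saddle point, and its existence has to be assumed in addition. *)
definition saddle_points ::
  "(real ^ 'd) set \<Rightarrow> (real ^ 'd \<Rightarrow> real) \<Rightarrow> real ^ 'd ^ 'r \<Rightarrow> real ^ 'r \<Rightarrow> ((real ^ 'd) \<times> (real ^ 'r)) set" where
  "saddle_points X f A b = {(xs, ys). xs \<in> X \<and>
     (\<forall>y. lagrangian f A b xs y \<le> lagrangian f A b xs ys) \<and>
     (\<forall>x\<in>X. lagrangian f A b xs ys \<le> lagrangian f A b x ys)}"

definition dual_step ::
  "real ^ 'd ^ ('l::finite \<times> 'n::finite) \<Rightarrow> real ^ ('l \<times> 'n) \<Rightarrow> 'l set \<Rightarrow> real \<Rightarrow>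
   real ^ ('l \<times> 'n) \<Rightarrow> real ^ 'd \<Rightarrow> real ^ ('l \<times> 'n)" where
  "dual_step A b I t y x = closest_point (Y_space I) (y + t *\<^sub>R (A *v x - b))"

definition pdm ::
  "(real ^ 'd) set \<Rightarrow> (real ^ 'd \<Rightarrow> real) \<Rightarrow> real ^ 'd ^ ('l::finite \<times> 'n::finite) \<Rightarrow> real ^ ('l \<times> 'n) \<Rightarrow>
   (nat \<Rightarrow> 'l set) \<Rightarrow> (nat \<Rightarrow> real) \<Rightarrow> (nat \<Rightarrow> (real ^ 'd) \<times> (real ^ ('l \<times> 'n))) \<Rightarrow> bool" where
  "pdm X f A b Is lam w \<longleftrightarrow>
     w 0 \<in> X \<times> Y_space (Is 0) \<and>
     (\<forall>k\<ge>1. lam k > 0 \<and>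
       (let x' = fst (w (k - 1)); y' = snd (w (k - 1));
            p = dual_step A b (Is k) (lam k) y' x'
        in is_arg_min (\<lambda>x. f x + p \<bullet> (A *v x - b) + 0.5 * inverse (lam k) * (norm (x - x'))\<^sup>2)
             (\<lambda>x. x \<in> X) (fst (w k)) \<and>
           snd (w k) = dual_step A b (Is k) (lam k) y' (fst (w k))))"

definition limit_point :: "(nat \<Rightarrow> 'a::topological_space) \<Rightarrow> 'a \<Rightarrow> bool" where
  "limit_point w z \<longleftrightarrow> (\<exists>r. strict_mono r \<and> (w \<circ> r) \<longlonglongrightarrow> z)"

(* lam k lies in [tau, sqrt (1 - tau) / (sqrt 2 * norm A_(k))]; if A_(k) = 0, there is no upper
   bound (HOL would evaluate the quotient to 0). *)
definition stepsize_rule ::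
  "real ^ 'd ^ ('l::finite \<times> 'n::finite) \<Rightarrow> (nat \<Rightarrow> 'l set) \<Rightarrow> (nat \<Rightarrow> real) \<Rightarrow> real \<Rightarrow> bool" where
  "stepsize_rule A Is lam \<tau> \<longleftrightarrow>
     (\<forall>k\<ge>1. \<tau> \<le> lam k \<and>
       (sub_blocks (Is k) A \<noteq> 0 \<longrightarrow>
          lam k \<le> sqrt (1 - \<tau>) / (sqrt 2 * onorm ((*v) (sub_blocks (Is k) A)))))"

end

theory Submission
  imports Defs
begin

text \<open>
  Write \<open>P\<^sub>J\<close> for the coordinate projection onto the blocks in \<open>J\<close>; it is the metric projection
  onto the multiplier space of \<open>J\<close>. The argument is a Fejer monotonicity argument with respect to
  saddle points, and the changing index sets enter it at two places.

  First, a basic index set \<open>I\<close> carries all constraints: the system is solvable, so every vector in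
  the kernel of \<open>A\<^sub>I\<close> lies in the kernel of \<open>A\<close>, hence the range of the transpose of \<open>A\<close> lies in that
  of the transpose of \<open>A\<^sub>I\<close>, and the multiplier of any saddle point can be replaced by one supported
  on \<open>I\<close> (\<open>saddle_point_with_multiplier_in_Y_space\<close>). Such a multiplier lies in the
  multiplier space of every iteration, because each of these belongs to a superset of \<open>I\<close>.

  Second, for a saddle point \<open>(x\<^sup>*, y\<^sup>*)\<close> of this kind, the three-point inequality of the proximal
  step, the saddle inequality and the projection formula for the new multiplier add up to
  \<open>V\<^sub>k + \<bar>\<Delta>x\<bar>\<^sup>2 + \<bar>p\<^sub>k - y\<^sub>k\<^sub>-\<^sub>1\<bar>\<^sup>2 \<le> V\<^sub>k\<^sub>-\<^sub>1 + \<bar>y\<^sub>k - p\<^sub>k\<bar>\<^sup>2\<close>, where \<open>V\<^sub>k\<close> is the squared distance of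
  the \<open>k\<close>-th iterate from the saddle point and \<open>\<Delta>x\<close> the primal step. As
  \<open>y\<^sub>k - p\<^sub>k = \<lambda>\<^sub>k P\<^sub>J A \<Delta>x\<close> with \<open>J\<close> the current index set, the stepsize rule makes the last
  term at most \<open>(1 - \<tau>) / 2\<close> times \<open>\<bar>\<Delta>x\<bar>\<^sup>2\<close>, so that \<open>V\<close> decreases (\<open>fejer_step\<close>).

  The iterates are therefore bounded, and the steps as well as the difference between predicted and
  corrected multipliers tend to zero. Since the stepsizes stay away from zero, the residuals of the
  constraints in \<open>I\<close> tend to zero too; a limit point is feasible for these, hence for all
  constraints, and the optimality condition of the proximal step passes to the limit
  (\<open>limit_point_is_saddle_point\<close>). Monotonicity of the distance is only known for saddle points with
  multiplier supported on \<open>I\<close>. If the index set is \<open>I\<close> itself infinitely often, some limit point has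
  such a multiplier; the distance to it is monotone and tends to zero along a subsequence, so the
  whole sequence converges.
\<close>

section \<open>Block projections\<close>

lemma sub_blocks_plus: "sub_blocks I (u + v) = sub_blocks I u + sub_blocks I v"
  for u :: "real ^ ('l::finite \<times> 'n::finite)"
  by (simp add: sub_blocks_def vec_eq_iff)

lemma sub_blocks_scaleR: "sub_blocks I (c *\<^sub>R u) = c *\<^sub>R sub_blocks I u"
  for u :: "real ^ ('l::finite \<times> 'n::finite)"
  by (simp add: sub_blocks_def vec_eq_iff)

lemma linear_sub_blocks:
  "linear (sub_blocks I :: real ^ ('l::finite \<times> 'n::finite) \<Rightarrow> real ^ ('l \<times> 'n))"
  by (intro linearI sub_blocks_plus sub_blocks_scaleR)

lemmas bounded_linear_sub_blocks = linear_sub_blocks[unfolded linear_conv_bounded_linear]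

lemma sub_blocks_matrix_mult: "sub_blocks I A *v x = sub_blocks I (A *v x)"
  for A :: "real ^ 'd ^ ('l::finite \<times> 'n::finite)"
  by (simp add: sub_blocks_def vec_eq_iff matrix_vector_mult_def)

lemma sub_blocks_sub_blocks: "I \<subseteq> J \<Longrightarrow> sub_blocks I (sub_blocks J v) = sub_blocks I v"
  by (auto simp: sub_blocks_def vec_eq_iff)

text \<open>
  Being idempotent and self-adjoint, a block projection moves freely across inner products; this is
  what makes the components that a change of index set discards invisible to the multipliers that
  it keeps.
\<close>

lemma sub_blocks_inner: "sub_blocks I u \<bullet> v = u \<bullet> sub_blocks I v"
  for u v :: "real ^ ('l::finite \<times> 'n::finite)"
  by (auto simp: sub_blocks_def inner_vec_def intro!: sum.cong)

lemma Y_space_eq: "Y_space I = {y. sub_blocks I y = y}"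
  by (auto simp: Y_space_def sub_blocks_def block_def vec_eq_iff)

lemma subspace_Y_space: "subspace (Y_space I)"
  by (auto simp: subspace_def Y_space_eq linear_0[OF linear_sub_blocks]
      sub_blocks_plus sub_blocks_scaleR)

lemma sub_blocks_in_Y_space: "sub_blocks I v \<in> Y_space I"
  by (simp add: Y_space_eq sub_blocks_sub_blocks)

lemma closest_point_Y_space: "closest_point (Y_space I) u = sub_blocks I u"
proof (rule closest_point_unique[symmetric])
  show "convex (Y_space I)" by (rule subspace_imp_convex[OF subspace_Y_space])
  show "closed (Y_space I)" by (rule closed_subspace[OF subspace_Y_space])
  show "sub_blocks I u \<in> Y_space I" by (rule sub_blocks_in_Y_space)
  show "\<forall>z\<in>Y_space I. dist u (sub_blocks I u) \<le> dist u z"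
    by (auto simp: dist_norm sub_blocks_def Y_space_def block_def vec_eq_iff
        intro!: norm_le_componentwise_cart)
qed

lemma dual_step_eq: "dual_step A b I t y x = sub_blocks I (y + t *\<^sub>R (A *v x - b))"
  by (simp add: dual_step_def closest_point_Y_space)

section \<open>Proximal minimisation\<close>

text \<open>
  For positive \<open>c\<close> the quadratic term makes the objective strongly convex, so a minimiser beats every
  competitor by a quadratic margin. Comparing the minimiser \<open>p\<close> with the point at parameter \<open>t\<close> on the segment from
  \<open>p\<close> to \<open>x\<close> and dividing by \<open>t\<close> loses only a factor \<open>1 - t\<close> of this margin.
\<close>

lemma prox_three_point:
  fixes g :: "'a::real_inner \<Rightarrow> real"
  assumes "convex X" and g: "convex_on X g"
    and min: "is_arg_min (\<lambda>x. g x + c * (norm (x - a))\<^sup>2) (\<lambda>x. x \<in> X) p"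
    and x: "x \<in> X"
  shows "g p + c * (norm (p - a))\<^sup>2 + c * (norm (x - p))\<^sup>2 \<le> g x + c * (norm (x - a))\<^sup>2"
proof -
  have p: "p \<in> X" and le: "\<And>z. z \<in> X \<Longrightarrow>
      g p + c * (norm (p - a))\<^sup>2 \<le> g z + c * (norm (z - a))\<^sup>2"
    using min by (auto simp: is_arg_min_linorder)
  (* What remains of the comparison at parameter t after division by t; R 0 is the claim. *)
  define R where "R t = g x - g p + c * (norm (x - a))\<^sup>2 - c * (norm (p - a))\<^sup>2
      - (1 - t) * (c * (norm (x - p))\<^sup>2)" for t :: real
  have pos: "0 \<le> R t" if t: "0 < t" "t < 1" for t
  proof -
    let ?z = "(1 - t) *\<^sub>R p + t *\<^sub>R x"
    have z: "?z \<in> X"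
      using \<open>convex X\<close> p x t by (simp add: convex_alt)
    have "g ?z \<le> (1 - t) * g p + t * g x"
      using convex_onD[OF g, of t p x] p x t by simp
    moreover have "(norm (?z - a))\<^sup>2
        = (1 - t) * (norm (p - a))\<^sup>2 + t * (norm (x - a))\<^sup>2 - t * (1 - t) * (norm (x - p))\<^sup>2"
      unfolding power2_norm_eq_inner
      by (simp add: inner_diff inner_add algebra_simps inner_commute)
    ultimately have "g p + c * (norm (p - a))\<^sup>2 \<le> (1 - t) * g p + t * g x
        + c * ((1 - t) * (norm (p - a))\<^sup>2 + t * (norm (x - a))\<^sup>2
               - t * (1 - t) * (norm (x - p))\<^sup>2)"
      using le[OF z] by simp
    then have "0 \<le> t * R t"
      by (simp add: R_def algebra_simps)
    then show ?thesis using t by (simp add: zero_le_mult_iff)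
  qed
  have "(R \<longlongrightarrow> R 0) (at_right 0)"
    unfolding R_def by (intro tendsto_intros)
  moreover have "\<forall>\<^sub>F t in at_right 0. 0 \<le> R t"
    using pos by (auto simp: eventually_at_right_field intro!: exI[of _ 1])
  ultimately have "0 \<le> R 0"
    by (intro tendsto_lowerbound[where F = "at_right (0::real)"]) auto
  then show ?thesis by (simp add: R_def)
qed

section \<open>Saddle points and basic index sets\<close>

text \<open>
  A function that is affine in \<open>y\<close> is bounded above only if it is constant, so maximality in \<open>y\<close> says
  no more than feasibility; moving \<open>y\<close> along the residual shows it.
\<close>

lemma saddle_points_iff:
  "(x, y) \<in> saddle_points X f A b \<longleftrightarrow>
     x \<in> X \<and> A *v x = b \<and> (\<forall>z\<in>X. f x \<le> f z + y \<bullet> (A *v z - b))"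
proof -
  have "A *v x = b" if le: "\<forall>v. lagrangian f A b x v \<le> lagrangian f A b x y"
  proof -
    have "(A *v x - b) \<bullet> (A *v x - b) \<le> 0"
      using le[rule_format, of "y + (A *v x - b)"] by (simp add: lagrangian_def inner_add_left)
    then show ?thesis
      by (metis inner_ge_zero inner_eq_zero_iff antisym eq_iff_diff_eq_0)
  qed
  then show ?thesis
    by (auto simp: saddle_points_def lagrangian_def)
qed

text \<open>The range of the adjoint is the orthogonal complement of the kernel.\<close>

lemma range_adjoint_mono:
  fixes f :: "'a::euclidean_space \<Rightarrow> 'b::euclidean_space" and g :: "'a \<Rightarrow> 'c::euclidean_space"
  assumes "linear f" "linear g" and ker: "f -` {0} \<subseteq> g -` {0}"
  shows "range (adjoint g) \<subseteq> range (adjoint f)"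
proof -
  have sub: "subspace (range (adjoint f))" "subspace (range (adjoint g))"
    using assms by (auto intro!: linear_subspace_image adjoint_linear)
  have "(g -` {0})\<^sup>\<bottom> \<subseteq> (f -` {0})\<^sup>\<bottom>"
    using ker by (auto simp: orthogonal_comp_def)
  then show ?thesis
    using assms sub by (simp add: ker_orthogonal_comp_adjoint orthogonal_comp_self)
qed

text \<open>
  The multiplier enters the saddle inequality only through the transpose of \<open>A\<close>, because \<open>b\<close> is the
  image of the primal part. As the system for \<open>I\<close> implies the full system, the kernel of \<open>A\<^sub>I\<close> is
  contained in that of \<open>A\<close>, so the transpose of \<open>A\<^sub>I\<close> takes the required value at some \<open>u\<close>, of which
  only the blocks in \<open>I\<close> matter.
\<close>

lemma saddle_point_with_multiplier_in_Y_space: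
  fixes A :: "real ^ 'd ^ ('l::finite \<times> 'n::finite)"
  assumes "basic A b I" and "(x, y) \<in> saddle_points X f A b"
  obtains y' where "y' \<in> Y_space I" and "(x, y') \<in> saddle_points X f A b"
proof -
  have Ax: "A *v x = b"
    using assms(2) by (simp add: saddle_points_iff)
  have "A *v v = 0" if "sub_blocks I A *v v = 0" for v
  proof -
    have "sub_blocks I A *v (x + v) = sub_blocks I b"
      using that Ax by (simp add: matrix_vector_right_distrib sub_blocks_matrix_mult)
    then have "sub_blocks UNIV A *v (x + v) = sub_blocks UNIV b"
      using assms(1) by (simp add: basic_def basic_wrt_def)
    then show ?thesis
      using Ax by (simp add: sub_blocks_def matrix_vector_right_distrib)
  qed
  then have "range (adjoint ((*v) A)) \<subseteq> range (adjoint ((*v) (sub_blocks I A)))"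
    by (intro range_adjoint_mono) auto
  then obtain u where u: "adjoint ((*v) A) y = adjoint ((*v) (sub_blocks I A)) u"
    by blast
  have eq: "y \<bullet> (A *v v) = sub_blocks I u \<bullet> (A *v v)" for v
  proof -
    have "(A *v v) \<bullet> y = v \<bullet> adjoint ((*v) A) y"
      by (rule adjoint_works[symmetric]) simp
    also have "\<dots> = (sub_blocks I A *v v) \<bullet> u"
      unfolding u by (rule adjoint_works) simp
    also have "\<dots> = (A *v v) \<bullet> sub_blocks I u"
      by (simp only: sub_blocks_matrix_mult sub_blocks_inner)
    finally show ?thesis by (simp only: inner_commute)
  qed
  have "y \<bullet> (A *v z - b) = sub_blocks I u \<bullet> (A *v z - b)" for z
    using eq[of "z - x"] Ax by (simp add: matrix_vector_mult_diff_distrib)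
  then have "(x, sub_blocks I u) \<in> saddle_points X f A b"
    using assms(2) by (simp add: saddle_points_iff)
  then show ?thesis using that sub_blocks_in_Y_space by blast
qed

section \<open>One iteration of the method\<close>

text \<open>
  Below, \<open>p k\<close> is the predicted multiplier computed from the iterate \<open>w k\<close>, that is, the one used in
  iteration \<open>k + 1\<close>; the indices of the method are shifted by one to avoid the predecessor.
\<close>

locale pdm_run =
  fixes X :: "(real ^ 'd::finite) set" and f :: "real ^ 'd \<Rightarrow> real"
    and A :: "real ^ 'd ^ ('l::finite \<times> 'n::finite)" and b :: "real ^ ('l \<times> 'n)"
    and Is :: "nat \<Rightarrow> 'l set" and lam :: "nat \<Rightarrow> real"
    and w :: "nat \<Rightarrow> (real ^ 'd) \<times> (real ^ ('l \<times> 'n))"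
    and \<tau> :: real and I :: "'l set"
  assumes convex_X: "convex X" and closed_X: "closed X" and convex_f: "convex_on UNIV f"
    and run: "pdm X f A b Is lam w"
    and tau: "0 < \<tau>" "\<tau> < 1" and steps: "stepsize_rule A Is lam \<tau>"
    and basic_I: "basic A b I" and I_subset: "\<And>k. 1 \<le> k \<Longrightarrow> I \<subseteq> Is k"
    and saddle_exists: "saddle_points X f A b \<noteq> {}"
begin

abbreviation x where "x k \<equiv> fst (w k)"
abbreviation y where "y k \<equiv> snd (w k)"
abbreviation p where "p k \<equiv> dual_step A b (Is (Suc k)) (lam (Suc k)) (y k) (x k)"

lemma x_Suc: "is_arg_min (\<lambda>z. (f z + p k \<bullet> (A *v z - b))
    + 0.5 * inverse (lam (Suc k)) * (norm (z - x k))\<^sup>2) (\<lambda>z. z \<in> X) (x (Suc k))"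
  using run by (auto simp: pdm_def Let_def dest!: spec[of _ "Suc k"])

lemma y_Suc: "y (Suc k) = sub_blocks (Is (Suc k)) (y k + lam (Suc k) *\<^sub>R (A *v x (Suc k) - b))"
  using run by (auto simp: pdm_def Let_def dual_step_eq dest!: spec[of _ "Suc k"])

lemma p_eq: "p k = sub_blocks (Is (Suc k)) (y k + lam (Suc k) *\<^sub>R (A *v x k - b))"
  by (rule dual_step_eq)

lemma lam_ge: "\<tau> \<le> lam (Suc k)"
  using steps by (simp add: stepsize_rule_def)

lemma x_in_X: "x k \<in> X"
proof (cases k)
  case 0
  then show ?thesis using run by (auto simp: pdm_def mem_Times_iff)
next
  case (Suc j)
  then show ?thesis using x_Suc[of j] by (simp add: is_arg_min_linorder)
qed

lemma y_in_Y_space: "y k \<in> Y_space (Is k)"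
proof (cases k)
  case 0
  then show ?thesis using run by (auto simp: pdm_def mem_Times_iff)
next
  case (Suc j)
  then show ?thesis by (simp add: y_Suc sub_blocks_in_Y_space)
qed

text \<open>
  The three-point inequality multiplied by twice the stepsize, the form in which it combines with
  the squared distances of the multipliers.
\<close>

lemma primal_step:
  assumes "z \<in> X"
  shows "2 * lam (Suc k) * (f (x (Suc k)) + p k \<bullet> (A *v x (Suc k) - b))
      + (norm (x (Suc k) - x k))\<^sup>2 + (norm (z - x (Suc k)))\<^sup>2
    \<le> 2 * lam (Suc k) * (f z + p k \<bullet> (A *v z - b)) + (norm (z - x k))\<^sup>2"
proof -
  have conv: "convex_on X (\<lambda>z. f z + p k \<bullet> (A *v z - b))"
  proof (intro convex_on_add)
    show "convex_on X f" using convex_f convex_X by (auto intro: convex_on_subset)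
    show "convex_on X (\<lambda>z. p k \<bullet> (A *v z - b))"
    proof (rule convex_onI)
      fix t :: real and u v assume "0 < t" "t < 1"
      have "A *v ((1 - t) *\<^sub>R u + t *\<^sub>R v) - b = (1 - t) *\<^sub>R (A *v u - b) + t *\<^sub>R (A *v v - b)"
        by (simp add: matrix_vector_right_distrib matrix_vector_mult_scaleR algebra_simps)
      then show "p k \<bullet> (A *v ((1 - t) *\<^sub>R u + t *\<^sub>R v) - b)
          \<le> (1 - t) * (p k \<bullet> (A *v u - b)) + t * (p k \<bullet> (A *v v - b))"
        by (simp only: inner_add_right inner_scaleR_right order_refl)
    qed (rule convex_X)
  qed
  (* Scaling the abstract inequality keeps arithmetic away from the large terms. *)
  have scaled: "2 * l * F + u + v \<le> 2 * l * G + q"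
    if "c = 0.5 * inverse l" "0 < l" "F + c * u + c * v \<le> G + c * q" for F G c l u v q :: real
  proof -
    have "2 * l * (F + c * u + c * v) \<le> 2 * l * (G + c * q)"
      using that by (intro mult_left_mono) auto
    moreover have "2 * l * c = 1" unfolding that(1) using that(2) by simp
    ultimately show ?thesis by (simp add: distrib_left mult.assoc[symmetric])
  qed
  show ?thesis
    by (rule scaled[OF refl _ prox_three_point[OF convex_X conv x_Suc assms]])
      (use lam_ge[of k] tau in simp)
qed

text \<open>
  The form of the optimality condition that passes to the limit: the error tends to zero with the
  primal step, uniformly over all stepsizes above \<open>\<tau>\<close>, so large stepsizes cannot spoil it.
\<close>

lemma primal_step_variational:
  assumes "z \<in> X"
  shows "f (x (Suc k)) + p k \<bullet> (A *v x (Suc k) - b)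
    \<le> f z + p k \<bullet> (A *v z - b) + norm (z - x (Suc k)) * norm (x (Suc k) - x k) / \<tau>"
proof -
  define F where "F v = f v + p k \<bullet> (A *v v - b)" for v
  define e where "e = x (Suc k) - x k"
  have l: "0 < lam (Suc k)" "\<tau> \<le> lam (Suc k)" using lam_ge[of k] tau by auto
  have "(norm (z - x k))\<^sup>2 = (norm (z - x (Suc k)))\<^sup>2 + 2 * ((z - x (Suc k)) \<bullet> e) + (norm e)\<^sup>2"
    unfolding power2_norm_eq_inner e_def by (simp add: inner_diff inner_commute algebra_simps)
  moreover have "(z - x (Suc k)) \<bullet> e \<le> norm (z - x (Suc k)) * norm e"
    by (rule norm_cauchy_schwarz)
  ultimately have "lam (Suc k) * (F (x (Suc k)) - F z) \<le> norm (z - x (Suc k)) * norm e"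
    using primal_step[OF assms, of k] unfolding F_def[symmetric] e_def[symmetric]
    by (simp add: algebra_simps)
  then have "F (x (Suc k)) - F z \<le> norm (z - x (Suc k)) * norm e / lam (Suc k)"
    using l by (simp add: field_simps)
  also have "\<dots> \<le> norm (z - x (Suc k)) * norm e / \<tau>"
    using l tau by (intro divide_left_mono) auto
  finally show ?thesis by (simp add: F_def e_def)
qed

text \<open>
  The upper bound on the stepsizes acts here alone. The old multiplier \<open>y k\<close> cancels in the
  difference, whether or not it lies in the new multiplier space, so only the primal step counts. If
  the selected blocks of \<open>A\<close> vanish, the predictor is exact for every stepsize.
\<close>

lemma predictor_error:
  "(norm (y (Suc k) - p k))\<^sup>2 \<le> (1 - \<tau>) / 2 * (norm (x (Suc k) - x k))\<^sup>2"
proof -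
  define M where "M = sub_blocks (Is (Suc k)) A"
  define v where "v = x (Suc k) - x k"
  define N where "N = onorm ((*v) M)"
  have l: "0 < lam (Suc k)" using lam_ge[of k] tau by auto
  have "y (Suc k) - p k = sub_blocks (Is (Suc k)) (lam (Suc k) *\<^sub>R (A *v v))"
    unfolding y_Suc p_eq linear_diff[OF linear_sub_blocks, symmetric] v_def
    by (simp add: matrix_vector_mult_diff_distrib scaleR_diff_right)
  then have "y (Suc k) - p k = lam (Suc k) *\<^sub>R (M *v v)"
    by (simp only: M_def sub_blocks_matrix_mult sub_blocks_scaleR)
  then have eq: "norm (y (Suc k) - p k) = lam (Suc k) * norm (M *v v)"
    using l by simp
  show ?thesis
  proof (cases "M = 0")
    case True
    then show ?thesis using eq tau by simp
  next
    case False
    then have "N > 0"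
      unfolding N_def by (subst onorm_pos_lt) (auto simp: matrix_eq)
    moreover have "lam (Suc k) \<le> sqrt (1 - \<tau>) / (sqrt 2 * N)"
      using steps False by (simp add: stepsize_rule_def M_def N_def)
    ultimately have lN: "lam (Suc k) * N \<le> sqrt ((1 - \<tau>) / 2)"
      by (simp add: real_sqrt_divide field_simps)
    have "norm (M *v v) \<le> N * norm v"
      unfolding N_def by (rule onorm) simp
    then have "norm (y (Suc k) - p k) \<le> (lam (Suc k) * N) * norm v"
      using l eq by (simp add: mult.assoc)
    also have "\<dots> \<le> sqrt ((1 - \<tau>) / 2) * norm v"
      using lN by (rule mult_right_mono) simp
    finally have "(norm (y (Suc k) - p k))\<^sup>2 \<le> (sqrt ((1 - \<tau>) / 2) * norm v)\<^sup>2"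
      by (rule power_mono) simp
    then show ?thesis
      using tau by (simp add: power_mult_distrib v_def)
  qed
qed

text \<open>
  Both \<open>ys\<close> and the predicted multiplier lie in the new multiplier space, so the projection in the
  multiplier update disappears when it is tested against \<open>ys - p k\<close>. This turns the coupling term
  left over by the primal step into \<open>(ys - p k) \<bullet> (y (Suc k) - y k)\<close>, which the
  expansion of the dual distance absorbs up to the error of the predictor.
\<close>

lemma fejer_step:
  assumes saddle: "(xs, ys) \<in> saddle_points X f A b" and ys: "ys \<in> Y_space I"
  shows "(dist (w (Suc k)) (xs, ys))\<^sup>2
      + ((1 + \<tau>) / 2 * (norm (x (Suc k) - x k))\<^sup>2 + (norm (p k - y k))\<^sup>2)
    \<le> (dist (w k) (xs, ys))\<^sup>2"
proof -
  let ?J = "Is (Suc k)" and ?l = "lam (Suc k)"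
  define r where "r = A *v x (Suc k) - b"
  have xs: "xs \<in> X" "A *v xs = b" "f xs \<le> f (x (Suc k)) + ys \<bullet> r"
    using saddle x_in_X by (auto simp: saddle_points_iff r_def)
  have l: "0 < ?l" using lam_ge[of k] tau by auto
  have "sub_blocks ?J ys = ys"
    using ys I_subset[of "Suc k"] unfolding Y_space_def
    by (auto simp: sub_blocks_def block_def vec_eq_iff)
  moreover have "sub_blocks ?J (p k) = p k"
    unfolding p_eq by (simp add: sub_blocks_sub_blocks)
  ultimately have fixed: "sub_blocks ?J (ys - p k) = ys - p k"
    by (simp add: linear_diff[OF linear_sub_blocks])
  have "(ys - p k) \<bullet> y (Suc k) = (ys - p k) \<bullet> (y k + ?l *\<^sub>R r)"
    unfolding y_Suc r_def[symmetric]
    by (metis fixed sub_blocks_inner)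
  then have dual: "?l * ((ys - p k) \<bullet> r) = (ys - p k) \<bullet> (y (Suc k) - y k)"
    by (simp add: inner_diff_right inner_add_right)
  have "2 * ?l * (f (x (Suc k)) + p k \<bullet> r) + (norm (x (Suc k) - x k))\<^sup>2 + (norm (xs - x (Suc k)))\<^sup>2
      \<le> 2 * ?l * f xs + (norm (xs - x k))\<^sup>2"
    using primal_step[OF xs(1), of k] xs(2) by (simp add: r_def)
  moreover have "2 * ?l * f xs \<le> 2 * ?l * (f (x (Suc k)) + ys \<bullet> r)"
    using xs(3) l by simp
  ultimately have primal: "(norm (x (Suc k) - xs))\<^sup>2 + (norm (x (Suc k) - x k))\<^sup>2
      \<le> (norm (x k - xs))\<^sup>2 + 2 * ((ys - p k) \<bullet> (y (Suc k) - y k))"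
    unfolding dual[symmetric] by (simp add: algebra_simps inner_diff_left norm_minus_commute)
  (* A four-point identity valid in every inner product space. *)
  have "(norm (y (Suc k) - ys))\<^sup>2 + 2 * ((ys - p k) \<bullet> (y (Suc k) - y k)) + (norm (p k - y k))\<^sup>2
      = (norm (y k - ys))\<^sup>2 + (norm (y (Suc k) - p k))\<^sup>2"
    unfolding power2_norm_eq_inner by (simp add: inner_diff inner_commute algebra_simps)
  with primal predictor_error[of k] show ?thesis
    by (simp add: dist_prod_def dist_norm algebra_simps) (simp add: field_simps)
qed

end

section \<open>Convergence\<close>

lemma decrements_tendsto_0:
  fixes V d :: "nat \<Rightarrow> real"
  assumes "\<And>k. 0 \<le> V k" "\<And>k. 0 \<le> d k" and step: "\<And>k. V (Suc k) + d k \<le> V k"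
  shows "d \<longlonglongrightarrow> 0"
proof -
  have "decseq V"
    using step assms(2) by (intro decseq_SucI) (smt (verit))
  then obtain L where L: "V \<longlonglongrightarrow> L"
    using assms(1) by (metis decseq_convergent)
  have "(\<lambda>k. V k - V (Suc k)) \<longlonglongrightarrow> L - L"
    by (intro tendsto_intros L LIMSEQ_Suc)
  then have "(\<lambda>k. V k - V (Suc k)) \<longlonglongrightarrow> 0" by simp
  then show ?thesis
    by (rule tendsto_sandwich[OF _ _ tendsto_const, rotated 2])
       (use assms(2) step in \<open>auto intro!: always_eventually simp: le_diff_eq add.commute\<close>)
qed

context pdm_run
begin

lemma dist_saddle_antimono:
  assumes "z \<in> saddle_points X f A b" "snd z \<in> Y_space I" "j \<le> k"
  shows "dist (w k) z \<le> dist (w j) z"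
proof (rule lift_Suc_antimono_le[OF _ assms(3)])
  fix i
  have "(dist (w (Suc i)) z)\<^sup>2 \<le> (dist (w i) z)\<^sup>2"
    using fejer_step[of "fst z" "snd z" i] assms(1,2) tau by (smt (verit) prod.collapse
        zero_le_power2 mult_nonneg_nonneg divide_nonneg_pos)
  then show "dist (w (Suc i)) z \<le> dist (w i) z"
    by (rule power2_le_imp_le) simp
qed

lemma saddle_in_Y_space_exists:
  obtains z where "z \<in> saddle_points X f A b" "snd z \<in> Y_space I"
  using saddle_exists saddle_point_with_multiplier_in_Y_space[OF basic_I]
  by (metis all_not_in_conv prod.collapse snd_conv)

lemma steps_tendsto_0:
  shows "(\<lambda>k. x (Suc k) - x k) \<longlonglongrightarrow> 0"
    and "(\<lambda>k. p k - y k) \<longlonglongrightarrow> 0"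
    and "(\<lambda>k. y (Suc k) - p k) \<longlonglongrightarrow> 0"
proof -
  obtain xs ys where z: "(xs, ys) \<in> saddle_points X f A b" "ys \<in> Y_space I"
    using saddle_in_Y_space_exists by (metis prod.collapse)
  let ?d = "\<lambda>k. (1 + \<tau>) / 2 * (norm (x (Suc k) - x k))\<^sup>2 + (norm (p k - y k))\<^sup>2"
  have d: "?d \<longlonglongrightarrow> 0"
    by (rule decrements_tendsto_0[where V = "\<lambda>k. (dist (w k) (xs, ys))\<^sup>2"])
      (use fejer_step[OF z] tau in auto)
  have "(\<lambda>k. (norm (p k - y k))\<^sup>2) \<longlonglongrightarrow> 0"
    by (rule tendsto_sandwich[OF _ _ tendsto_const d]) (use tau in auto)
  then show "(\<lambda>k. p k - y k) \<longlonglongrightarrow> 0"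
    by (simp add: tendsto_norm_zero_iff power_tendsto_0_iff)
  have dx: "(\<lambda>k. (1 + \<tau>) / 2 * (norm (x (Suc k) - x k))\<^sup>2) \<longlonglongrightarrow> 0"
    by (rule tendsto_sandwich[OF _ _ tendsto_const d]) (use tau in auto)
  then show "(\<lambda>k. x (Suc k) - x k) \<longlonglongrightarrow> 0"
    using tau by (simp add: tendsto_mult_left_iff tendsto_norm_zero_iff power_tendsto_0_iff)
  have "(\<lambda>k. (norm (y (Suc k) - p k))\<^sup>2) \<longlonglongrightarrow> 0"
  proof (rule tendsto_sandwich[OF _ _ tendsto_const dx])
    have "(norm (y (Suc k) - p k))\<^sup>2 \<le> (1 + \<tau>) / 2 * (norm (x (Suc k) - x k))\<^sup>2" for k
      using predictor_error[of k] tau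
      by (elim order_trans) (intro mult_right_mono, auto)
    then show "\<forall>\<^sub>F k in sequentially.
        (norm (y (Suc k) - p k))\<^sup>2 \<le> (1 + \<tau>) / 2 * (norm (x (Suc k) - x k))\<^sup>2"
      by simp
  qed simp
  then show "(\<lambda>k. y (Suc k) - p k) \<longlonglongrightarrow> 0"
    by (simp add: tendsto_norm_zero_iff power_tendsto_0_iff)
qed

text \<open>
  Restricted to \<open>I\<close>, which every index set contains, the multiplier update involves no projection: it
  adds the residual times a stepsize of at least \<open>\<tau>\<close>. The multipliers move less and less, so the
  residual vanishes.
\<close>

lemma residual_tendsto_0: "(\<lambda>k. sub_blocks I (A *v x (Suc k) - b)) \<longlonglongrightarrow> 0"
proof (rule Lim_null_comparison)
  show "(\<lambda>k. norm (sub_blocks I (y (Suc k) - y k)) / \<tau>) \<longlonglongrightarrow> 0"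
  proof -
    have "(\<lambda>k. (y (Suc k) - p k) + (p k - y k)) \<longlonglongrightarrow> 0 + 0"
      by (intro tendsto_add steps_tendsto_0)
    then have "(\<lambda>k. sub_blocks I (y (Suc k) - y k)) \<longlonglongrightarrow> sub_blocks I 0"
      by (intro bounded_linear.tendsto[OF bounded_linear_sub_blocks]) simp
    then have "(\<lambda>k. norm (sub_blocks I (y (Suc k) - y k)) / \<tau>) \<longlonglongrightarrow> norm (0::real^('l \<times> 'n)) / \<tau>"
      using tau by (intro tendsto_intros) (auto simp: linear_0[OF linear_sub_blocks])
    then show ?thesis by simp
  qed
  have "norm (sub_blocks I (A *v x (Suc k) - b)) \<le> norm (sub_blocks I (y (Suc k) - y k)) / \<tau>" for k
  proof -
    let ?r = "sub_blocks I (A *v x (Suc k) - b)"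
    have "sub_blocks I (y (Suc k)) = sub_blocks I (y k + lam (Suc k) *\<^sub>R (A *v x (Suc k) - b))"
      unfolding y_Suc using I_subset[of "Suc k"] by (simp add: sub_blocks_sub_blocks)
    then have "sub_blocks I (y (Suc k) - y k) = lam (Suc k) *\<^sub>R ?r"
      by (simp only: linear_diff[OF linear_sub_blocks] sub_blocks_plus sub_blocks_scaleR)
        (simp add: algebra_simps)
    then have "norm (sub_blocks I (y (Suc k) - y k)) = lam (Suc k) * norm ?r"
      using lam_ge[of k] tau by simp
    moreover have "\<tau> * norm ?r \<le> lam (Suc k) * norm ?r"
      using lam_ge by (rule mult_right_mono) simp
    ultimately show ?thesis
      using tau by (simp add: field_simps)
  qed
  then show "\<forall>\<^sub>F k in sequentially.
      norm (sub_blocks I (A *v x (Suc k) - b)) \<le> norm (sub_blocks I (y (Suc k) - y k)) / \<tau>"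
    by simp
qed

text \<open>
  Feasibility comes from the residuals on \<open>I\<close> and the defining property of a basic index set;
  optimality is the limit of the variational inequalities, in which the predicted multipliers may
  replace the iterates since the difference vanishes.
\<close>

lemma limit_point_is_saddle_point:
  assumes "limit_point w z"
  shows "z \<in> saddle_points X f A b"
proof -
  obtain r where r: "strict_mono r" and lim: "(w \<circ> r) \<longlonglongrightarrow> z"
    using assms by (auto simp: limit_point_def)
  (* The step leading to the iterate r (Suc i); skipping r 0, which may be 0, makes the
     predecessor genuine. *)
  define j where "j i = r (Suc i) - 1" for i
  have pos: "0 < r (Suc i)" for i
    using seq_suble[OF r, of "Suc i"] by linarith
  have Suc_j: "Suc (j i) = r (Suc i)" for i
    using pos[of i] by (simp add: j_def)
  have j: "strict_mono j"
    unfolding strict_mono_Suc_iff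
  proof
    fix i
    have "r (Suc i) < r (Suc (Suc i))" using r by (simp add: strict_mono_Suc_iff)
    then show "j i < j (Suc i)" using Suc_j[of i] Suc_j[of "Suc i"] by linarith
  qed
  have null: "(\<lambda>i. g (j i)) \<longlonglongrightarrow> 0" if "g \<longlonglongrightarrow> 0" for g :: "nat \<Rightarrow> 'z::real_normed_vector"
    using LIMSEQ_subseq_LIMSEQ[OF that j] by (simp add: comp_def)
  have w_lim: "(\<lambda>i. w (Suc (j i))) \<longlonglongrightarrow> z"
    using LIMSEQ_Suc[OF lim] by (simp add: Suc_j comp_def)
  obtain xb yb where z: "z = (xb, yb)" by fastforce
  have x_lim: "(\<lambda>i. x (Suc (j i))) \<longlonglongrightarrow> xb" and y_lim: "(\<lambda>i. y (Suc (j i))) \<longlonglongrightarrow> yb"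
    using tendsto_fst[OF w_lim] tendsto_snd[OF w_lim] by (simp_all add: z)
  have A_lim: "(\<lambda>i. A *v x (Suc (j i)) - b) \<longlonglongrightarrow> A *v xb - b"
    by (intro tendsto_intros bounded_linear.tendsto[OF matrix_vector_mul_bounded_linear] x_lim)
  have p_lim: "(\<lambda>i. p (j i)) \<longlonglongrightarrow> yb"
    using tendsto_diff[OF y_lim null[OF steps_tendsto_0(3)]] by simp
  have f_lim: "(\<lambda>i. f (x (Suc (j i)))) \<longlonglongrightarrow> f xb"
    using convex_on_continuous[OF open_UNIV convex_f]
    by (intro continuous_on_tendsto_compose[OF _ x_lim]) auto
  have xb: "xb \<in> X"
    using closed_sequentially[OF closed_X _ x_lim] x_in_X by blast
  have "sub_blocks I (A *v xb - b) = 0"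
    by (rule LIMSEQ_unique[OF bounded_linear.tendsto[OF bounded_linear_sub_blocks A_lim] null[OF residual_tendsto_0]])
  then have "sub_blocks I A *v xb = sub_blocks I b"
    by (simp add: linear_diff[OF linear_sub_blocks] sub_blocks_matrix_mult)
  then have feasible: "A *v xb = b"
    using basic_I by (simp add: basic_def basic_wrt_def sub_blocks_def)
  have "f xb \<le> f v + yb \<bullet> (A *v v - b)" if v: "v \<in> X" for v
  proof -
    have "f xb + yb \<bullet> (A *v xb - b)
        \<le> f v + yb \<bullet> (A *v v - b) + norm (v - xb) * norm (0 :: real ^ 'd) / \<tau>"
    proof (rule LIMSEQ_le)
      show "(\<lambda>i. f (x (Suc (j i))) + p (j i) \<bullet> (A *v x (Suc (j i)) - b))
          \<longlonglongrightarrow> f xb + yb \<bullet> (A *v xb - b)"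
        by (intro tendsto_intros f_lim p_lim A_lim)
      show "(\<lambda>i. f v + p (j i) \<bullet> (A *v v - b)
            + norm (v - x (Suc (j i))) * norm (x (Suc (j i)) - x (j i)) / \<tau>)
          \<longlonglongrightarrow> f v + yb \<bullet> (A *v v - b) + norm (v - xb) * norm (0 :: real ^ 'd) / \<tau>"
        using tau by (intro tendsto_intros p_lim x_lim null[OF steps_tendsto_0(1)]) auto
    qed (use primal_step_variational[OF v] in blast)
    then show ?thesis by (simp add: feasible)
  qed
  then show ?thesis
    by (simp add: z saddle_points_iff xb feasible)
qed

text \<open>
  Stated for arbitrary subsequences so that it also yields a limit point along those iterates whose
  index set is exactly \<open>I\<close>.
\<close>

lemma subsequence_has_limit_point:
  fixes r :: "nat \<Rightarrow> nat"
  obtains q z where "strict_mono q" "(w \<circ> r \<circ> q) \<longlonglongrightarrow> z"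
proof -
  obtain z where z: "z \<in> saddle_points X f A b" "snd z \<in> Y_space I"
    by (rule saddle_in_Y_space_exists)
  have "range (w \<circ> r) \<subseteq> cball z (dist (w 0) z)"
    using dist_saddle_antimono[OF z, of 0] by (auto simp: dist_commute)
  then have "bounded (range (w \<circ> r))"
    using bounded_subset bounded_cball by blast
  from bounded_imp_convergent_subsequence[OF this] show ?thesis
    using that by blast
qed

lemma limit_point_exists: "\<exists>z. limit_point w z"
  using subsequence_has_limit_point[of id] by (metis comp_id limit_point_def)

text \<open>
  The multiplier space of \<open>I\<close> is closed, so a limit point of the iterates computed with the index set
  \<open>I\<close> has its multiplier there. This is the kind of saddle point for which the distance is monotone,
  and a monotone sequence that tends to zero along a subsequence tends to zero.
\<close>

lemma convergence_if_basic_infinitely_often: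
  fixes r :: "nat \<Rightarrow> nat"
  assumes r: "strict_mono r" and eq: "\<And>s. Is (r s) = I"
  shows "\<exists>z\<in>saddle_points X f A b. w \<longlonglongrightarrow> z"
proof -
  obtain q z where q: "strict_mono q" and lim: "(w \<circ> r \<circ> q) \<longlonglongrightarrow> z"
    by (rule subsequence_has_limit_point[of r])
  have rq: "strict_mono (r \<circ> q)" using r q by (rule strict_mono_o)
  then have "limit_point w z"
    using lim unfolding limit_point_def comp_assoc by blast
  then have z: "z \<in> saddle_points X f A b"
    by (rule limit_point_is_saddle_point)
  have "snd z \<in> Y_space I"
  proof (rule closed_sequentially[OF closed_subspace[OF subspace_Y_space]])
    show "(\<lambda>i. y (r (q i))) \<longlonglongrightarrow> snd z"
      using tendsto_snd[OF lim] by (simp add: comp_def)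
    show "y (r (q i)) \<in> Y_space I" for i
      using y_in_Y_space[of "r (q i)"] by (simp add: eq)
  qed
  note anti = dist_saddle_antimono[OF z this]
  have "w \<longlonglongrightarrow> z"
  proof (rule metric_LIMSEQ_I)
    fix e :: real assume "0 < e"
    then obtain i where "dist (w (r (q i))) z < e"
      using metric_LIMSEQ_D[OF lim] by (auto simp: comp_def)
    then show "\<exists>N. \<forall>k\<ge>N. dist (w k) z < e"
      using anti by (meson order_le_less_trans)
  qed
  with z show ?thesis by blast
qed

end

theorem theorem2:
  fixes X :: "(real ^ ('m::finite \<times> 'n::finite)) set"
    and f :: "real ^ ('m \<times> 'n) \<Rightarrow> real"
    and A :: "real ^ ('m \<times> 'n) ^ ('l::finite \<times> 'n)"
    and b :: "real ^ ('l \<times> 'n)"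
    and Is :: "nat \<Rightarrow> 'l set"
    and lam :: "nat \<Rightarrow> real"
    and w :: "nat \<Rightarrow> (real ^ ('m \<times> 'n)) \<times> (real ^ ('l \<times> 'n))"
    and \<tau> :: real
    and I :: "'l set"
  assumes "convex X" and "closed X"
    and "solutions X f A b \<noteq> {}"
    and "saddle_points X f A b \<noteq> {}"
    and "convex_on UNIV f"
    and "pdm X f A b Is lam w"
    and "0 < \<tau>" and "\<tau> < 1"
    and "stepsize_rule A Is lam \<tau>"
    and "I \<noteq> {}" and "basic A b I"
    and "\<forall>k\<ge>1. I \<subseteq> Is k"
  shows "((\<exists>z. limit_point w z) \<and> (\<forall>z. limit_point w z \<longrightarrow> z \<in> saddle_points X f A b)) \<and>
    ((\<exists>r :: nat \<Rightarrow> nat. strict_mono r \<and> (\<forall>s. Is (r s) = I)) \<longrightarrow>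
       (\<exists>ws\<in>saddle_points X f A b. w \<longlonglongrightarrow> ws))"
proof -
  interpret pdm_run X f A b Is lam w \<tau> I
    using assms by unfold_locales auto
  show ?thesis
    using limit_point_exists limit_point_is_saddle_point convergence_if_basic_infinitely_often
    by blast
qed

end
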